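(* Let $\alpha\in\mathbb R$ be a cubic irrationality and $\alpha_{n+1}$ the tails in its continued fraction $\alpha=[a_1,\dots,a_n,\alpha_{n+1}]$, where $n=0,1,2,\dots$\,. Then for the conjugates $\sigma_1(\alpha_{n+1}),\sigma_2(\alpha_{n+1})$ we have the following limit relation: \[ q_n^2\cdot|\sigma_1(\alpha_{n+1})-\sigma_2(\alpha_{n+1})|\to\beta=\bigg|\frac{\sigma_1(\alpha)-\sigma_2(\alpha)}{(\alpha-\sigma_1(\alpha))(\alpha-\sigma_2(\alpha))}\bigg| \quad\text{as}\; n\to\infty. \]
   Context: For a real irrational $\alpha$, the continued fraction is defined by $a_1=\lfloor\alpha\rfloor$, $\alpha=a_1+1/\alpha_2$ with $\alpha_2>1$, and inductively $a_n=\lfloor\alpha_n\rfloor$, $\alpha_n=a_n+1/\alpha_{n+1}$ with $\alpha_{n+1}>1$; thus $\alpha=[a_1,\dots,a_n,\alpha_{n+1}]$ for $n=0,1,2,\dots$ (with $\alpha_1=\alpha$). The $n$th convergent is $p_n/q_n=[a_1,\dots,a_n]$, where $\begin{pmatrix} p_n & p_{n-1} \\ q_n & q_{n-1}\end{pmatrix}=\begin{pmatrix} a_1 & 1 \\ 1 & 0\end{pmatrix}\dotsb\begin{pmatrix} a_n & 1 \\ 1 & 0\end{pmatrix}$ for $n\ge1$, with conventions $p_0=1$, $q_0=0$. For $\gamma\in K=\mathbb Q(\alpha)$, $\sigma_1(\gamma),\sigma_2(\gamma)$ denote the two conjugates of $\gamma$ different from $\gamma$. *)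

theory Defs
  imports
    "HOL-Analysis.Analysis"
    "HOL-Computational_Algebra.Polynomial_Factorial"
begin

definition rat_min_poly :: "'a::field_char_0 \<Rightarrow> rat poly" where
  "rat_min_poly x =
     (THE p. lead_coeff p = 1 \<and> irreducible p \<and> poly (map_poly of_rat p) x = 0)"

(* The guard "algebraic" is needed because rat_min_poly is unspecified at transcendental arguments. *)
definition cubic_irrationality :: "real \<Rightarrow> bool" where
  "cubic_irrationality x \<longleftrightarrow> algebraic x \<and> degree (rat_min_poly x) = 3"

definition conjugates :: "real \<Rightarrow> complex set" where
  "conjugates x = {z. poly (map_poly of_rat (rat_min_poly x)) z = 0}"

definition is_subfield :: "'a::field set \<Rightarrow> bool" where
  "is_subfield F \<longleftrightarrow> 0 \<in> F \<and> 1 \<in> F \<and>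
     (\<forall>x\<in>F. \<forall>y\<in>F. x - y \<in> F \<and> x * y \<in> F) \<and> (\<forall>x\<in>F. inverse x \<in> F)"

(* The field Q(x): the smallest subfield containing x; in characteristic 0
   every subfield contains the rationals. *)
definition rat_adjoin :: "'a::field_char_0 \<Rightarrow> 'a set" where
  "rat_adjoin x = \<Inter> {F. is_subfield F \<and> x \<in> F}"

(* Tails are counted by the number of partial quotients removed, partial quotients from 1:
   cf_tail x n is x_(n+1) in x = [a_1, ..., a_n, x_(n+1)], so a_n = floor (cf_tail x (n - 1)). *)
primrec cf_tail :: "real \<Rightarrow> nat \<Rightarrow> real" where
  "cf_tail x 0 = x"
| "cf_tail x (Suc n) = 1 / (cf_tail x n - of_int \<lfloor>cf_tail x n\<rfloor>)"

definition cf_quotient :: "real \<Rightarrow> nat \<Rightarrow> int" where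
  "cf_quotient x n = \<lfloor>cf_tail x (n - 1)\<rfloor>"

(* The matrix with rows (p_n, p_(n-1)) and (q_n, q_(n-1)); the empty product at n = 0
   gives the conventions p_0 = 1, q_0 = 0. *)
primrec cf_matrix :: "real \<Rightarrow> nat \<Rightarrow> int^2^2" where
  "cf_matrix x 0 = mat 1"
| "cf_matrix x (Suc n) =
     cf_matrix x n ** vector [vector [cf_quotient x (Suc n), 1], vector [1, 0]]"

definition cf_num :: "real \<Rightarrow> nat \<Rightarrow> int" where
  "cf_num x n = cf_matrix x n $ 1 $ 1"

definition cf_denom :: "real \<Rightarrow> nat \<Rightarrow> int" where
  "cf_denom x n = cf_matrix x n $ 2 $ 1"

end

theory Submission
  imports Defs
begin

text \<open>
  Write \<open>\<alpha> = (p\<^sub>n \<gamma> + p\<^sub>n\<^sub>-\<^sub>1) / (q\<^sub>n \<gamma> + q\<^sub>n\<^sub>-\<^sub>1)\<close> with \<open>\<gamma> = \<alpha>\<^sub>n\<^sub>+\<^sub>1\<close>. Applying the inverse Moebius map to a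
  conjugate \<open>z\<close> of \<open>\<alpha>\<close> gives the conjugate \<open>- (q\<^sub>n\<^sub>-\<^sub>1 z - p\<^sub>n\<^sub>-\<^sub>1) / (q\<^sub>n z - p\<^sub>n)\<close> of \<open>\<gamma>\<close>. As the
  matrix of the map has determinant \<open>\<plusminus>1\<close>, the difference of the two conjugates of \<open>\<gamma>\<close> is, up to
  sign, \<open>(z\<^sub>1 - z\<^sub>2) / ((q\<^sub>n z\<^sub>1 - p\<^sub>n) (q\<^sub>n z\<^sub>2 - p\<^sub>n))\<close>. Multiplying by \<open>q\<^sub>n\<^sup>2\<close> and using
  \<open>p\<^sub>n / q\<^sub>n \<rightarrow> \<alpha>\<close> yields the limit.
\<close>

section \<open>Evaluation of rational polynomials in a field of characteristic 0\<close>

lemma poly_of_rat_add: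
  "poly (map_poly of_rat (p + q)) (z :: 'a::field_char_0) =
     poly (map_poly of_rat p) z + poly (map_poly of_rat q) z"
proof -
  have "map_poly of_rat (p + q) = map_poly of_rat p + (map_poly of_rat q :: 'a poly)"
    by (intro poly_eqI) (simp add: coeff_map_poly of_rat_add)
  then show ?thesis by simp
qed

lemma poly_of_rat_mult:
  "poly (map_poly of_rat (p * q)) (z :: 'a::field_char_0) =
     poly (map_poly of_rat p) z * poly (map_poly of_rat q) z"
  by (induction p)
    (simp_all add: poly_of_rat_add map_poly_pCons map_poly_smult of_rat_mult algebra_simps)

lemma poly_of_rat_pcompose:
  "poly (map_poly of_rat (pcompose p q)) (z :: 'a::field_char_0) =
     poly (map_poly of_rat p) (poly (map_poly of_rat q) z)"
  by (induction p)
    (simp_all add: pcompose_pCons poly_of_rat_add poly_of_rat_mult map_poly_pCons)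

lemma poly_of_rat_reflect_poly:
  assumes "(z :: 'a::field_char_0) \<noteq> 0"
  shows "poly (map_poly of_rat (reflect_poly p)) z =
           z ^ degree p * poly (map_poly of_rat p) (inverse z)"
proof -
  have deg: "degree (map_poly of_rat p :: 'a poly) = degree p"
    by (rule degree_map_poly) simp
  have "map_poly of_rat (reflect_poly p) = (reflect_poly (map_poly of_rat p) :: 'a poly)"
    by (intro poly_eqI) (simp add: coeff_map_poly coeff_reflect_poly deg)
  then show ?thesis using assms by (simp add: poly_reflect_poly_nz deg)
qed

section \<open>Minimal polynomials and conjugates over the rationals\<close>

lemma algebraic_iff_rat_poly:
  "algebraic (x :: 'a::field_char_0) \<longleftrightarrow> (\<exists>p. p \<noteq> 0 \<and> poly (map_poly of_rat p) x = 0)"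
proof
  assume "algebraic x"
  then obtain p where p: "p \<noteq> 0" "poly (map_poly of_int p) x = 0" by (rule algebraicE')
  have "map_poly of_rat (map_poly of_int p) = (map_poly of_int p :: 'a poly)"
    by (simp add: map_poly_map_poly comp_def)
  moreover have "map_poly of_int p \<noteq> (0 :: rat poly)"
    using p(1) by (subst map_poly_eq_0_iff) auto
  ultimately show "\<exists>p. p \<noteq> 0 \<and> poly (map_poly of_rat p) x = 0" using p(2) by metis
next
  assume "\<exists>p. p \<noteq> 0 \<and> poly (map_poly of_rat p) x = 0"
  then obtain p where p: "p \<noteq> 0" "poly (map_poly of_rat p) x = 0" by blast
  show "algebraic x"
  proof (rule algebraicI')
    show "coeff (map_poly of_rat p) i \<in> \<rat>" for i by (simp add: coeff_map_poly)
    show "map_poly of_rat p \<noteq> (0 :: 'a poly)"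
      using p(1) by (subst map_poly_eq_0_iff) auto
  qed (fact p(2))
qed

text \<open>A nonzero annihilating polynomial of least degree divides every other one, since the
  remainder would annihilate \<open>x\<close> with smaller degree. Its monic multiple
  \<open>m\<close> is irreducible: if \<open>m = a * b\<close>, one factor annihilates
  \<open>x\<close> and is thus divisible by \<open>m\<close>, so the other is a unit.\<close>

lemma rat_min_poly_properties:
  fixes x :: "'a::field_char_0"
  assumes "algebraic x"
  shows "lead_coeff (rat_min_poly x) = 1"
    and "irreducible (rat_min_poly x)"
    and "poly (map_poly of_rat (rat_min_poly x)) x = 0"
    and "\<And>p. poly (map_poly of_rat p) x = 0 \<Longrightarrow> rat_min_poly x dvd p"
proof -
  define V where "V p \<longleftrightarrow> poly (map_poly of_rat p) x = 0" for p
  define m0 where "m0 = arg_min degree (\<lambda>p. p \<noteq> 0 \<and> V p)"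
  have ex: "\<exists>p. p \<noteq> 0 \<and> V p" using assms by (simp add: algebraic_iff_rat_poly V_def)
  then have m0: "m0 \<noteq> 0" "V m0" and least: "\<And>p. p \<noteq> 0 \<Longrightarrow> V p \<Longrightarrow> degree m0 \<le> degree p"
    using arg_min_nat_lemma[of "\<lambda>p. p \<noteq> 0 \<and> V p" _ degree] unfolding m0_def by blast+
  have m0_dvd: "m0 dvd p" if "V p" for p
  proof (rule ccontr)
    assume ndvd: "\<not> m0 dvd p"
    have "V (p div m0 * m0 + p mod m0)" using that by simp
    then have "V (p mod m0)"
      using m0(2) unfolding V_def poly_of_rat_add poly_of_rat_mult by simp
    moreover have "p mod m0 \<noteq> 0" using ndvd by (simp add: dvd_eq_mod_eq_0)
    ultimately have "degree m0 \<le> degree (p mod m0)" using least by blast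
    with degree_mod_less_degree[OF m0(1) ndvd] show False by simp
  qed
  have V_mult: "V (a * b) \<longleftrightarrow> V a \<or> V b" for a b by (simp add: V_def poly_of_rat_mult)
  have not_unit: "\<not> p dvd 1" if "V p" for p
  proof
    assume "p dvd 1"
    then obtain k where "1 = p * k" ..
    then have "V 1" using that V_mult by metis
    then show False by (simp add: V_def)
  qed
  define m where "m = smult (inverse (lead_coeff m0)) m0"
  have m: "lead_coeff m = 1" "m \<noteq> 0" "V m"
    using m0 by (auto simp: m_def V_def map_poly_smult of_rat_mult)
  have m_dvd: "m dvd p" if "V p" for p
    using m0_dvd[OF that] m0(1) by (simp add: m_def smult_dvd_iff)
  have irr: "irreducible m"
  proof (rule irreducibleI)
    show "\<not> m dvd 1" using not_unit m(3) .
    fix a b assume ab: "m = a * b"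
    then have nz: "a \<noteq> 0" "b \<noteq> 0" using m(2) by auto
    from ab m(3) have "V a \<or> V b" by (simp add: V_mult)
    then show "a dvd 1 \<or> b dvd 1"
    proof
      assume "V a"
      then have "a * b dvd a * 1" using m_dvd ab by simp
      then show ?thesis using nz by (subst (asm) dvd_times_left_cancel_iff) auto
    next
      assume "V b"
      then have "b * a dvd b * 1" using m_dvd ab by (simp add: mult.commute)
      then show ?thesis using nz by (subst (asm) dvd_times_left_cancel_iff) auto
    qed
  qed (fact m(2))
  \<comment> \<open>The description in \<open>rat_min_poly\<close> is meaningful only once
    uniqueness is known: a monic irreducible annihilator is \<open>m\<close> times a unit, and
    comparing leading coefficients makes the unit 1.\<close>
  have "rat_min_poly x = m"
    unfolding rat_min_poly_def
  proof (rule the_equality)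
    fix p assume p: "lead_coeff p = 1 \<and> irreducible p \<and> poly (map_poly of_rat p) x = 0"
    then obtain c where c: "p = m * c" using m_dvd[of p] by (auto simp: V_def)
    with p have "c dvd 1" using irreducibleD[of p m c] not_unit[OF m(3)] by auto
    then obtain d where d: "c = [:d:]" by (auto simp: is_unit_poly_iff)
    moreover from p c have "lead_coeff m * lead_coeff c = 1" by (simp flip: lead_coeff_mult)
    ultimately show "p = m" using c m(1) by simp
  qed (use m irr in \<open>simp add: V_def\<close>)
  then show "lead_coeff (rat_min_poly x) = 1" "irreducible (rat_min_poly x)"
    "poly (map_poly of_rat (rat_min_poly x)) x = 0"
    "\<And>p. poly (map_poly of_rat p) x = 0 \<Longrightarrow> rat_min_poly x dvd p"
    using m irr m_dvd by (simp_all add: V_def)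
qed

text \<open>This form lets conjugacy be carried from one tail to the next by transforming arbitrary
  annihilating polynomials, without computing the minimal polynomial of a tail.\<close>

lemma conjugates_iff:
  assumes "algebraic x"
  shows "z \<in> conjugates x \<longleftrightarrow>
           (\<forall>p. poly (map_poly of_rat p) x = 0 \<longrightarrow> poly (map_poly of_rat p) z = 0)"
proof
  assume z: "z \<in> conjugates x"
  show "\<forall>p. poly (map_poly of_rat p) x = 0 \<longrightarrow> poly (map_poly of_rat p) z = 0"
  proof (intro allI impI)
    fix p assume "poly (map_poly of_rat p) x = 0"
    then obtain c where "p = rat_min_poly x * c"
      using rat_min_poly_properties(4)[OF assms] by (auto elim: dvdE)
    then show "poly (map_poly of_rat p) z = 0"
      using z by (simp add: poly_of_rat_mult conjugates_def)
  qed
qed (use rat_min_poly_properties(3)[OF assms] in \<open>simp add: conjugates_def\<close>)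

text \<open>A rational root would split the irreducible cubic into a linear and a quadratic factor,
  neither a unit. The type of \<open>z\<close> is left open to cover both the real number
  \<open>x\<close> and its complex conjugates.\<close>

lemma cubic_irrationality_no_rat_root:
  fixes z :: "'a::field_char_0"
  assumes "cubic_irrationality x" "poly (map_poly of_rat (rat_min_poly x)) z = 0"
  shows "z \<notin> \<rat>"
proof
  assume "z \<in> \<rat>"
  then obtain r where r: "z = of_rat r" by (auto elim: Rats_cases)
  define m where "m = rat_min_poly x"
  have alg: "algebraic x" and deg: "degree m = 3"
    using assms by (auto simp: cubic_irrationality_def m_def)
  have of_rat_poly: "poly (map_poly of_rat p) (of_rat r :: 'a) = of_rat (poly p r)" for p
    by (induction p) (simp_all add: map_poly_pCons of_rat_add of_rat_mult)
  have "poly m r = 0" using assms(2) by (simp add: r of_rat_poly m_def)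
  then obtain c where c: "m = [:-r, 1:] * c" by (auto simp: poly_eq_0_iff_dvd)
  have nz: "c \<noteq> 0" using c deg by auto
  have "degree m = 1 + degree c" unfolding c using nz by (subst degree_mult_eq) auto
  then have "degree c = 2" using deg by simp
  moreover have "[:-r, 1:] dvd 1 \<or> c dvd 1"
    using rat_min_poly_properties(2)[OF alg] c irreducibleD unfolding m_def by blast
  ultimately show False by (auto simp: is_unit_poly_iff)
qed

text \<open>If \<open>P(X)\<close> vanishes at \<open>1/(x - a)\<close>, then clearing denominators in \<open>P(1/(X - a))\<close> gives a
  polynomial vanishing at \<open>x\<close>, hence at every conjugate of \<open>x\<close>.\<close>

lemma conjugates_inverse_shift:
  fixes x :: real and a :: int
  assumes alg: "algebraic x" and "x \<noteq> of_int a" "z \<noteq> of_int a" "z \<in> conjugates x"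
  shows "algebraic (1 / (x - of_int a))"
    and "1 / (z - of_int a) \<in> conjugates (1 / (x - of_int a))"
proof -
  obtain p where p: "p \<noteq> 0" "poly (map_poly of_rat p) x = 0"
    using alg by (auto simp: algebraic_iff_rat_poly)
  \<comment> \<open>Since p(X + a) vanishes at x - a, its reversal vanishes at 1/(x - a).\<close>
  define r where "r = reflect_poly (pcompose p [:of_int a, 1:])"
  have "r \<noteq> 0" using p(1) by (auto simp: r_def dest: pcompose_eq_0)
  moreover have "poly (map_poly of_rat r) (1 / (x - of_int a)) = 0"
    using p(2) assms(2)
    by (simp add: r_def poly_of_rat_reflect_poly poly_of_rat_pcompose map_poly_pCons)
  ultimately show alg': "algebraic (1 / (x - of_int a))"
    by (auto simp: algebraic_iff_rat_poly)
  \<comment> \<open>Polymorphic in \<open>w\<close>, as it is used at the real \<open>x\<close> and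
    at the complex \<open>z\<close>.\<close>
  have clear: "poly (map_poly of_rat (pcompose (reflect_poly p) [:- of_int a, 1:])) w =
      (w - of_int a) ^ degree p * poly (map_poly of_rat p) (1 / (w - of_int a))"
    if "w \<noteq> of_int a" for w :: "'a::field_char_0" and p
    using that poly_of_rat_reflect_poly[of "w - of_int a" p]
    by (simp add: poly_of_rat_pcompose map_poly_pCons of_rat_minus inverse_eq_divide)
  show "1 / (z - of_int a) \<in> conjugates (1 / (x - of_int a))"
    unfolding conjugates_iff[OF alg']
  proof (intro allI impI)
    fix p assume "poly (map_poly of_rat p) (1 / (x - of_int a)) = 0"
    then have "poly (map_poly of_rat (pcompose (reflect_poly p) [:- of_int a, 1:])) x = 0"
      using clear[OF assms(2)] by simp
    then have "poly (map_poly of_rat (pcompose (reflect_poly p) [:- of_int a, 1:])) z = 0"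
      using assms(4) conjugates_iff[OF alg] by blast
    then show "poly (map_poly of_rat p) (1 / (z - of_int a)) = 0"
      using clear[OF assms(3)] assms(3) by simp
  qed
qed

section \<open>Tails of the continued fraction\<close>

lemma is_subfield_of_int:
  assumes "is_subfield F"
  shows "of_int k \<in> F"
proof -
  have diff: "x - y \<in> F" if "x \<in> F" "y \<in> F" for x y
    using assms that by (simp add: is_subfield_def)
  have F01: "0 \<in> F" "1 \<in> F" using assms by (auto simp: is_subfield_def)
  have "of_nat n \<in> F" for n
  proof (induction n)
    case (Suc n)
    have "of_nat n - (0 - 1) \<in> F" using Suc F01 diff by blast
    then show ?case by (simp add: add.commute)
  qed (use F01 in simp)
  then show ?thesis using diff[OF F01(1)] by (cases k rule: int_cases2) auto
qed

text \<open>Needed because the conjugates are prescribed by \<sigma>1 and \<sigma>2 only on the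
  field generated by \<alpha>.\<close>

lemma cf_tail_in_rat_adjoin: "cf_tail x n \<in> rat_adjoin x"
proof (induction n)
  case (Suc n)
  have "cf_tail x (Suc n) \<in> F" if "is_subfield F" "x \<in> F" for F
  proof -
    have "cf_tail x n \<in> F" using Suc that by (auto simp: rat_adjoin_def)
    then have "inverse (cf_tail x n - of_int \<lfloor>cf_tail x n\<rfloor>) \<in> F"
      using that(1) is_subfield_of_int[OF that(1)] by (auto simp: is_subfield_def)
    then show ?thesis by (simp add: inverse_eq_divide)
  qed
  then show ?case unfolding rat_adjoin_def by blast
qed (simp add: rat_adjoin_def)

lemma cf_tail_irrational:
  assumes "x \<notin> \<rat>"
  shows "cf_tail x n \<notin> \<rat>"
proof (induction n)
  case (Suc n)
  show ?case
  proof
    assume "cf_tail x (Suc n) \<in> \<rat>"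
    then have "1 / cf_tail x (Suc n) + of_int \<lfloor>cf_tail x n\<rfloor> \<in> \<rat>"
      by (intro Rats_add Rats_divide) auto
    then show False using Suc by simp
  qed
qed (use assms in simp)

lemma cf_tail_minus_floor:
  assumes "x \<notin> \<rat>"
  shows "0 < cf_tail x n - of_int \<lfloor>cf_tail x n\<rfloor>" "cf_tail x n - of_int \<lfloor>cf_tail x n\<rfloor> < 1"
proof -
  have "cf_tail x n \<noteq> of_int \<lfloor>cf_tail x n\<rfloor>"
    using cf_tail_irrational[OF assms, of n] by (metis Rats_of_int)
  then show "0 < cf_tail x n - of_int \<lfloor>cf_tail x n\<rfloor>" by linarith
qed linarith

lemma cf_tail_gt_1:
  assumes "x \<notin> \<rat>"
  shows "cf_tail x (Suc n) > 1"
  using cf_tail_minus_floor[OF assms, of n] by simp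

section \<open>Matrices of the convergents and the associated linear forms\<close>

lemma cf_matrix_step:
  "cf_matrix x (Suc n) $ i $ 1 =
     cf_matrix x n $ i $ 1 * \<lfloor>cf_tail x n\<rfloor> + cf_matrix x n $ i $ 2"
  "cf_matrix x (Suc n) $ i $ 2 = cf_matrix x n $ i $ 1"
  by (simp_all add: matrix_matrix_mult_def sum_2 cf_quotient_def)

lemma cf_matrix_0:
  "cf_matrix x 0 $ 1 $ 1 = 1" "cf_matrix x 0 $ 1 $ 2 = 0"
  "cf_matrix x 0 $ 2 $ 1 = 0" "cf_matrix x 0 $ 2 $ 2 = 1"
  by (simp_all add: mat_def)

lemma abs_det_cf_matrix: "\<bar>det (cf_matrix x n)\<bar> = 1"
proof (induction n)
  case (Suc n)
  have "det (cf_matrix x (Suc n)) = - det (cf_matrix x n)"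
    unfolding det_2 cf_matrix_step by (simp add: algebra_simps)
  then show ?case using Suc by simp
qed simp

text \<open>From q_2 on, each partial quotient is at least 1, so a denominator is at least the sum
  of the two before it. The induction also tracks the preceding denominator, which is positive only
  for \<open>n > 0\<close> because q_0 = 0.\<close>

lemma cf_denom_ge:
  assumes "x \<notin> \<rat>"
  shows "cf_denom x (Suc n) \<ge> 1 \<and> cf_denom x (Suc n) \<ge> int n"
proof -
  have "1 \<le> cf_matrix x (Suc n) $ 2 $ 1 \<and> int n \<le> cf_matrix x (Suc n) $ 2 $ 1 \<and>
        0 \<le> cf_matrix x (Suc n) $ 2 $ 2 \<and> (n > 0 \<longrightarrow> 1 \<le> cf_matrix x (Suc n) $ 2 $ 2)"
  proof (induction n)
    case 0
    then show ?case by (simp add: cf_matrix_step cf_matrix_0 del: cf_matrix.simps)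
  next
    case (Suc n)
    let ?q = "cf_matrix x (Suc n) $ 2 $ 1" and ?q' = "cf_matrix x (Suc n) $ 2 $ 2"
    have "1 \<le> \<lfloor>cf_tail x (Suc n)\<rfloor>" using cf_tail_gt_1[OF assms, of n] by linarith
    then have "?q \<le> ?q * \<lfloor>cf_tail x (Suc n)\<rfloor>"
      using Suc mult_left_mono[of 1 "\<lfloor>cf_tail x (Suc n)\<rfloor>" ?q] by linarith
    then show ?case
      unfolding cf_matrix_step(1)[of x "Suc n"] cf_matrix_step(2)[of x "Suc n"] using Suc
      by (cases "n = 0"; intro conjI impI; linarith)
  qed
  then show ?thesis by (simp add: cf_denom_def)
qed

text \<open>The form \<open>q\<^sub>n z - p\<^sub>n\<close>; the column argument \<open>j = 2\<close> gives \<open>q\<^sub>n\<^sub>-\<^sub>1 z - p\<^sub>n\<^sub>-\<^sub>1\<close>.\<close>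

definition cf_form :: "real \<Rightarrow> nat \<Rightarrow> 2 \<Rightarrow> 'a \<Rightarrow> 'a::field_char_0" where
  "cf_form x n j z = of_int (cf_matrix x n $ 2 $ j) * z - of_int (cf_matrix x n $ 1 $ j)"

lemma cf_form_0: "cf_form x 0 1 z = -1" "cf_form x 0 2 z = z"
  unfolding cf_form_def cf_matrix_0 by simp_all

lemma cf_form_step:
  "cf_form x (Suc n) 1 z = of_int \<lfloor>cf_tail x n\<rfloor> * cf_form x n 1 z + cf_form x n 2 z"
  "cf_form x (Suc n) 2 z = cf_form x n 1 z"
  unfolding cf_form_def cf_matrix_step by (simp_all add: algebra_simps)

lemma cf_form_nonzero:
  assumes "x \<notin> \<rat>" "z \<notin> \<rat>"
  shows "cf_form x n 1 z \<noteq> 0"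
proof (cases n)
  case (Suc k)
  have q: "cf_matrix x n $ 2 $ 1 \<noteq> 0"
    using cf_denom_ge[OF assms(1), of k] Suc by (simp add: cf_denom_def del: cf_matrix.simps)
  show ?thesis
  proof
    assume "cf_form x n 1 z = 0"
    then have "z = of_int (cf_matrix x n $ 1 $ 1) / of_int (cf_matrix x n $ 2 $ 1)"
      using q by (simp add: cf_form_def field_simps)
    then show False using assms(2) by simp
  qed
qed (simp add: cf_form_0)

text \<open>This is \<alpha> = (p_n \<gamma> + p_(n-1)) / (q_n \<gamma> + q_(n-1)), with \<gamma>
  the tail, after clearing denominators.\<close>

lemma cf_form_tail:
  assumes "x \<notin> \<rat>"
  shows "cf_form x n 2 x = - cf_tail x n * cf_form x n 1 x"
proof (induction n)
  case (Suc n)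
  show ?case
    using cf_tail_minus_floor[OF assms, of n] Suc by (simp add: cf_form_step field_simps)
qed (simp add: cf_form_0)

text \<open>By \<open>cf_form_tail\<close>, each value is the previous one divided, up to sign, by a
  tail exceeding 1, so the absolute values decrease from 1. Since q_n tends to infinity, this crude
  bound suffices for convergence.\<close>

lemma abs_cf_form_le_1:
  assumes "x \<notin> \<rat>"
  shows "\<bar>cf_form x n 1 x\<bar> \<le> 1"
proof (induction n)
  case (Suc n)
  have "\<bar>cf_form x (Suc n) 1 x\<bar> \<le> cf_tail x (Suc n) * \<bar>cf_form x (Suc n) 1 x\<bar>"
    using cf_tail_gt_1[OF assms, of n] by (intro mult_le_cancel_right1[THEN iffD2]) auto
  also have "\<dots> = \<bar>cf_form x n 1 x\<bar>"
    using cf_form_tail[OF assms, of "Suc n"] cf_tail_gt_1[OF assms, of n]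
    by (simp add: cf_form_step(2) abs_mult)
  finally show ?case using Suc by simp
qed (simp add: cf_form_0)

lemma cf_convergents_tendsto:
  assumes "x \<notin> \<rat>"
  shows "(\<lambda>n. real_of_int (cf_num x n) / real_of_int (cf_denom x n)) \<longlonglongrightarrow> x"
\<comment> \<open>The shift by 2 skips q_0 = 0 and makes the denominators at least
  \<open>Suc n\<close>.\<close>
proof (rule LIMSEQ_offset[where k = 2], rule Lim_null[THEN iffD2])
  have "norm (real_of_int (cf_num x (n + 2)) / real_of_int (cf_denom x (n + 2)) - x)
          \<le> 1 / real (Suc n)" for n
  proof -
    let ?p = "real_of_int (cf_num x (n + 2))" and ?q = "real_of_int (cf_denom x (n + 2))"
    have q: "?q \<ge> real (Suc n)" using cf_denom_ge[OF assms, of "Suc n"] by simp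
    then have "?p / ?q - x = - cf_form x (n + 2) 1 x / ?q"
      by (simp add: cf_form_def cf_num_def cf_denom_def field_simps del: cf_matrix.simps)
    then have "norm (?p / ?q - x) = \<bar>cf_form x (n + 2) 1 x\<bar> / ?q" using q by simp
    also have "\<dots> \<le> 1 / real (Suc n)"
      using q abs_cf_form_le_1[OF assms] by (intro frac_le) auto
    finally show ?thesis .
  qed
  then show "(\<lambda>n. real_of_int (cf_num x (n + 2)) / real_of_int (cf_denom x (n + 2)) - x)
               \<longlonglongrightarrow> 0"
    by (intro Lim_null_comparison[OF _ LIMSEQ_Suc[OF lim_1_over_n]] always_eventually) simp
qed

text \<open>Subtracting the partial quotient and inverting sends the quotient of forms at
  \<open>n\<close> to the one at \<open>Suc n\<close>, and \<open>conjugates_inverse_shift\<close>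
  says that this operation preserves conjugacy. Irrationality of \<open>z\<close> keeps all
  denominators nonzero.\<close>

lemma cf_tail_conjugate:
  assumes "algebraic x" "x \<notin> \<rat>" "z \<in> conjugates x" "z \<notin> \<rat>"
  shows "algebraic (cf_tail x n) \<and> - cf_form x n 2 z / cf_form x n 1 z \<in> conjugates (cf_tail x n)"
proof (induction n)
  case (Suc n)
  let ?a = "\<lfloor>cf_tail x n\<rfloor>" and ?w = "- cf_form x n 2 z / cf_form x n 1 z"
  have nz: "cf_form x n 1 z \<noteq> 0" "cf_form x (Suc n) 1 z \<noteq> 0"
    using cf_form_nonzero assms by blast+
  have w: "?w - of_int ?a = - cf_form x (Suc n) 1 z / cf_form x n 1 z"
    using nz(1) by (simp add: cf_form_step field_simps)
  then have "?w \<noteq> of_int ?a" using nz by force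
  moreover have "cf_tail x n \<noteq> of_int ?a" using cf_tail_minus_floor(1)[OF assms(2), of n] by simp
  ultimately have "algebraic (cf_tail x (Suc n))"
    "1 / (?w - of_int ?a) \<in> conjugates (cf_tail x (Suc n))"
    using conjugates_inverse_shift[of "cf_tail x n" ?a ?w] Suc by simp_all
  then show ?case unfolding w by (simp add: cf_form_step(2))
qed (use assms in \<open>simp add: cf_form_0\<close>)

text \<open>Over the common denominator, the numerator is alternating in \<open>y\<close> and
  \<open>z\<close>: the products \<open>y * z\<close> and the constants cancel, leaving the
  determinant times \<open>y - z\<close>.\<close>

lemma cf_form_quotient_diff:
  assumes "cf_form x n 1 y \<noteq> 0" "cf_form x n 1 z \<noteq> 0"
  shows "- cf_form x n 2 y / cf_form x n 1 y - - cf_form x n 2 z / cf_form x n 1 z =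
           of_int (det (cf_matrix x n)) * (y - z) / (cf_form x n 1 y * cf_form x n 1 z)"
proof -
  have "- cf_form x n 2 y * cf_form x n 1 z + cf_form x n 2 z * cf_form x n 1 y =
          of_int (det (cf_matrix x n)) * (y - z)"
    unfolding det_2 cf_form_def by (simp add: algebra_simps)
  then show ?thesis using assms by (simp add: divide_simps)
qed

theorem theorem2:
  fixes \<alpha> :: real and \<sigma>1 \<sigma>2 :: "real \<Rightarrow> complex"
  assumes "cubic_irrationality \<alpha>"
    and "\<And>\<gamma>. \<gamma> \<in> rat_adjoin \<alpha> \<Longrightarrow> \<gamma> \<notin> \<rat> \<Longrightarrow>
           \<sigma>1 \<gamma> \<noteq> \<sigma>2 \<gamma> \<and> conjugates \<gamma> - {complex_of_real \<gamma>} = {\<sigma>1 \<gamma>, \<sigma>2 \<gamma>}"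
  shows "(\<lambda>n. (real_of_int (cf_denom \<alpha> n))\<^sup>2 * cmod (\<sigma>1 (cf_tail \<alpha> n) - \<sigma>2 (cf_tail \<alpha> n)))
           \<longlonglongrightarrow> cmod ((\<sigma>1 \<alpha> - \<sigma>2 \<alpha>) /
                 ((complex_of_real \<alpha> - \<sigma>1 \<alpha>) * (complex_of_real \<alpha> - \<sigma>2 \<alpha>)))"
proof -
  have alg: "algebraic \<alpha>" using assms(1) by (simp add: cubic_irrationality_def)
  have irr: "\<alpha> \<notin> \<rat>"
    using cubic_irrationality_no_rat_root[OF assms(1)] rat_min_poly_properties(3)[OF alg] by blast
  have conj_irr: "z \<notin> \<rat>" if "z \<in> conjugates \<alpha>" for z
    using cubic_irrationality_no_rat_root[OF assms(1), of z] that by (simp add: conjugates_def)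
  define z1 z2 where "z1 = \<sigma>1 \<alpha>" and "z2 = \<sigma>2 \<alpha>"
  have "\<alpha> \<in> rat_adjoin \<alpha>" using cf_tail_in_rat_adjoin[of \<alpha> 0] by simp
  then have "z1 \<noteq> z2" and zs: "conjugates \<alpha> - {complex_of_real \<alpha>} = {z1, z2}"
    using assms(2) irr by (auto simp: z1_def z2_def)
  have z1: "z1 \<in> conjugates \<alpha>" "z1 \<noteq> of_real \<alpha>" and z2: "z2 \<in> conjugates \<alpha>" "z2 \<noteq> of_real \<alpha>"
    using zs by blast+
  \<comment> \<open>With \<alpha> itself among the conjugates, injectivity of \<open>w n\<close>
    keeps the images of \<open>z1\<close> and \<open>z2\<close> away from the tail.\<close>
  have a: "complex_of_real \<alpha> \<in> conjugates \<alpha>"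
  proof -
    have "complex_of_rat r = of_real (of_rat r)" for r
      by (cases r) (simp add: of_rat_rat)
    then have "poly (map_poly of_rat p) (complex_of_real \<alpha>) = of_real (poly (map_poly of_rat p) \<alpha>)" for p
      by (induction p) (simp_all add: map_poly_pCons)
    then show ?thesis using rat_min_poly_properties(3)[OF alg] by (simp add: conjugates_def)
  qed
  define w where "w n z = - cf_form \<alpha> n 2 z / cf_form \<alpha> n 1 z" for n and z :: complex
  have nz: "cf_form \<alpha> n 1 z \<noteq> 0" if "z \<in> conjugates \<alpha>" for n z
    using cf_form_nonzero irr conj_irr that by blast
  have diff: "w n y - w n z =
      of_int (det (cf_matrix \<alpha> n)) * (y - z) / (cf_form \<alpha> n 1 y * cf_form \<alpha> n 1 z)"
    if "y \<in> conjugates \<alpha>" "z \<in> conjugates \<alpha>" for n y z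
    using cf_form_quotient_diff[OF nz[OF that(1)] nz[OF that(2)]] by (simp add: w_def)
  have inj: "w n y \<noteq> w n z" if "y \<in> conjugates \<alpha>" "z \<in> conjugates \<alpha>" "y \<noteq> z" for n y z
  proof -
    have "w n y - w n z \<noteq> 0"
      using abs_det_cf_matrix[of \<alpha> n] that nz by (subst diff) auto
    then show ?thesis by simp
  qed
  have w_tail: "w n (complex_of_real \<alpha>) = complex_of_real (cf_tail \<alpha> n)" for n
  proof -
    have of_real: "cf_form \<alpha> n j (complex_of_real \<alpha>) = of_real (cf_form \<alpha> n j \<alpha>)" for j
      by (simp add: cf_form_def)
    have "cf_form \<alpha> n 1 \<alpha> \<noteq> 0" using cf_form_nonzero irr by blast
    then show ?thesis unfolding w_def of_real cf_form_tail[OF irr] by simp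
  qed
  \<comment> \<open>The labels \<sigma>1 and \<sigma>2 are chosen separately for each number, so
    \<open>w n z1\<close> and \<open>w n z2\<close> are the two conjugates of the tail in unknown
    order. The absolute difference does not depend on it.\<close>
  have dist: "cmod (\<sigma>1 (cf_tail \<alpha> n) - \<sigma>2 (cf_tail \<alpha> n)) = cmod (w n z1 - w n z2)" for n
  proof -
    have "w n z \<in> conjugates (cf_tail \<alpha> n)" if "z \<in> conjugates \<alpha>" for z
      using cf_tail_conjugate[OF alg irr that conj_irr[OF that]] by (simp add: w_def)
    then have "{w n z1, w n z2} \<subseteq> conjugates (cf_tail \<alpha> n) - {complex_of_real (cf_tail \<alpha> n)}"
      using z1 z2 inj[OF z1(1) a z1(2), of n] inj[OF z2(1) a z2(2), of n] by (simp add: w_tail)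
    also have "\<dots> = {\<sigma>1 (cf_tail \<alpha> n), \<sigma>2 (cf_tail \<alpha> n)}"
      using assms(2) cf_tail_in_rat_adjoin cf_tail_irrational[OF irr] by blast
    finally have "w n z1 = \<sigma>1 (cf_tail \<alpha> n) \<and> w n z2 = \<sigma>2 (cf_tail \<alpha> n) \<or>
        w n z1 = \<sigma>2 (cf_tail \<alpha> n) \<and> w n z2 = \<sigma>1 (cf_tail \<alpha> n)"
      using inj[OF z1(1) z2(1) \<open>z1 \<noteq> z2\<close>, of n] by auto
    then show ?thesis by (auto simp: norm_minus_commute)
  qed
  define c where "c n = complex_of_real (real_of_int (cf_num \<alpha> n) / real_of_int (cf_denom \<alpha> n))"
    for n
  \<comment> \<open>Each form is -q_n times (c_n - z), so the two forms contribute exactly the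
    factor q_n^2 that cancels. The case \<open>n = 0\<close> is excluded since q_0 = 0.\<close>
  have eq: "(real_of_int (cf_denom \<alpha> n))\<^sup>2 * cmod (\<sigma>1 (cf_tail \<alpha> n) - \<sigma>2 (cf_tail \<alpha> n)) =
      cmod ((z1 - z2) / ((c n - z1) * (c n - z2)))" if "n \<ge> 1" for n
  proof -
    let ?q = "complex_of_int (cf_denom \<alpha> n)"
    have q: "cf_denom \<alpha> n \<noteq> 0" using cf_denom_ge[OF irr, of "n - 1"] that by simp
    have form: "cf_form \<alpha> n 1 z = - ?q * (c n - z)" for z
      using q by (simp add: cf_form_def c_def cf_num_def cf_denom_def field_simps)
    have "cmod (of_int (det (cf_matrix \<alpha> n))) = 1"
      using abs_det_cf_matrix[of \<alpha> n] by (simp del: of_int_abs flip: of_int_abs)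
    then have "cmod (w n z1 - w n z2) = cmod (z1 - z2) / cmod (?q\<^sup>2 * ((c n - z1) * (c n - z2)))"
      unfolding diff[OF z1(1) z2(1)] form
      by (simp add: norm_mult norm_divide power2_eq_square mult_ac)
    then show ?thesis unfolding dist using q by (simp add: norm_mult norm_divide norm_power)
  qed
  have "c \<longlonglongrightarrow> complex_of_real \<alpha>"
    unfolding c_def by (intro tendsto_of_real cf_convergents_tendsto irr)
  \<comment> \<open>Continuity applies because \<open>z1\<close> and \<open>z2\<close> differ from
    \<alpha>, so the limiting denominator is nonzero.\<close>
  then have "(\<lambda>n. cmod ((z1 - z2) / ((c n - z1) * (c n - z2))))
      \<longlonglongrightarrow> cmod ((z1 - z2) / ((complex_of_real \<alpha> - z1) * (complex_of_real \<alpha> - z2)))"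
    using z1 z2 by (intro tendsto_intros) auto
  moreover have "eventually (\<lambda>n. cmod ((z1 - z2) / ((c n - z1) * (c n - z2))) =
      (real_of_int (cf_denom \<alpha> n))\<^sup>2 * cmod (\<sigma>1 (cf_tail \<alpha> n) - \<sigma>2 (cf_tail \<alpha> n))) sequentially"
    using eq by (intro eventually_sequentiallyI[of 1]) simp
  ultimately show ?thesis
    unfolding z1_def z2_def by (rule Lim_transform_eventually)
qed

end
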